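(* Let $D_{\mathrm{KL}}(\gamma,\delta)$ denote the expected token-wise Kullback–Leibler divergence, with direction from the watermarked next-token distribution to the original next-token distribution, of the logit-shift watermark with green-list fraction $\gamma\in(0,1)$ and logit bias $\delta>0$. Under the large-vocabulary plug-in approximation $P(x\in G)\approx\gamma$ (the probability that the unwatermarked next token $x$ lies in the green list $G$ is approximated by $\gamma$), let $$\gamma'=\gamma'(\gamma,\delta)=\frac{e^{\delta}\gamma}{1+\gamma(e^{\delta}-1)}$$ be the corresponding approximation to the effective green-token probability, i.e. the probability that the watermarked next token lies in $G$. Then (under this plug-in approximation) $$D_{\mathrm{KL}}(\gamma,\delta)=\delta\,\gamma'(\gamma,\delta)-\log\left(1+\gamma(e^\delta-1)\right).$$ Given $\gamma$, $D_{\mathrm{KL}}(\gamma,\delta)$ is strictly increasing in $\delta$ for all $\delta>0$: $$\frac{\partial}{\partial\delta}D_{\mathrm{KL}}(\gamma,\delta)>0.$$ As $\delta$ varies with $\gamma$ fixed, $D_{\mathrm{KL}}(\gamma,\delta)$ is upper bounded by the choice of $\gamma$: $$\sup_{\delta}D_{\mathrm{KL}}(\gamma,\delta)=-\log\gamma.$$ As $\gamma$ varies with $\delta$ fixed, $D_{\mathrm{KL}}(\gamma,\delta)$ attains its maximum at $$\gamma_0(\delta)=\frac{\delta e^\delta-(e^\delta-1)}{(e^\delta-1)^2}.$$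
   Context: A language model generates tokens from a finite vocabulary $V$. At each generation step $i$, given the preceding tokens, it has a next-token distribution $P_i$ on $V$ (the softmax of the model's logits). The watermark pseudo-randomly selects a green list $G_i\subset V$ of size $\gamma|V|$ and adds a constant $\delta>0$ to the logits of the tokens in $G_i$, giving the watermarked next-token distribution $Q_i(v)=\dfrac{e^{\delta\mathbf 1\{v\in G_i\}}P_i(v)}{\sum_{u\in V}e^{\delta\mathbf 1\{u\in G_i\}}P_i(u)}$. The token-wise divergence at step $i$ is $D_{\mathrm{KL}}(Q_i\,\|\,P_i)=\sum_{v\in V}Q_i(v)\log\frac{Q_i(v)}{P_i(v)}$, and $D_{\mathrm{KL}}(\gamma,\delta)$ is its expected value. The green mass $P_i(G_i)$ is in general random; the plug-in approximation replaces it by $\gamma$, near which it is expected to concentrate when $|V|$ is large. Under this approximation the green-list indicator $\mathbf 1\{x\in G\}$ is treated as $\mathrm{Bernoulli}(\gamma)$ without the watermark and as $\mathrm{Bernoulli}(\gamma')$ with it. The formula for $D_{\mathrm{KL}}(\gamma,\delta)$ is a plug-in formula in this sense, and the monotonicity, supremum and maximizer statements concern the function of $(\gamma,\delta)$ given by it. $\log$ is the natural logarithm. *)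

theory Defs
  imports "HOL-Probability.Probability"
begin

definition softmax :: "('v::finite \<Rightarrow> real) \<Rightarrow> 'v pmf" where
  "softmax l = embed_pmf (\<lambda>v. exp (l v) / (\<Sum>u\<in>UNIV. exp (l u)))"

definition watermarked :: "('v::finite \<Rightarrow> real) \<Rightarrow> 'v set \<Rightarrow> real \<Rightarrow> 'v pmf" where
  "watermarked l G \<delta> = softmax (\<lambda>v. l v + \<delta> * indicator G v)"

(* D_KL(Q || P) in nats. The library's KL_divergence b M N is the divergence of N from M
   (it integrates log b (dN/dM) against N), hence the order of the arguments. *)
definition kl :: "'a pmf \<Rightarrow> 'a pmf \<Rightarrow> real" where
  "kl Q P = KL_divergence (exp 1) (measure_pmf P) (measure_pmf Q)"

definition eff_green :: "real \<Rightarrow> real \<Rightarrow> real" where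
  "eff_green \<gamma> \<delta> = exp \<delta> * \<gamma> / (1 + \<gamma> * (exp \<delta> - 1))"

(* The plug-in divergence: the green-list indicator is Bernoulli(\<gamma>) without the watermark
   and Bernoulli(eff_green \<gamma> \<delta>) with it. *)
definition plugin_kl :: "real \<Rightarrow> real \<Rightarrow> real" where
  "plugin_kl \<gamma> \<delta> = kl (bernoulli_pmf (eff_green \<gamma> \<delta>)) (bernoulli_pmf \<gamma>)"

definition peak_fraction :: "real \<Rightarrow> real" where
  "peak_fraction \<delta> = (\<delta> * exp \<delta> - (exp \<delta> - 1)) / (exp \<delta> - 1)\<^sup>2"

(* One generation step. The vocabulary is the finite type 'v; the probability space M carries
   the preceding tokens and the watermark's pseudo-randomness, so the logits L and the green
   list G are random, with an arbitrary joint law (G may depend on the context). *)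
locale watermark_step = prob_space M
  for M :: "'w measure" +
  fixes L :: "'w \<Rightarrow> 'v::finite \<Rightarrow> real" and G :: "'w \<Rightarrow> 'v set" and \<gamma> :: real
  assumes logits_measurable: "\<And>v. (\<lambda>\<omega>. L \<omega> v) \<in> borel_measurable M"
    and green_measurable: "G \<in> M \<rightarrow>\<^sub>M count_space UNIV"
    and card_green: "\<And>\<omega>. \<omega> \<in> space M \<Longrightarrow> real (card (G \<omega>)) = \<gamma> * real CARD('v)"

definition token_kl :: "('v::finite \<Rightarrow> real) \<Rightarrow> 'v set \<Rightarrow> real \<Rightarrow> real" where
  "token_kl l G \<delta> = kl (watermarked l G \<delta>) (softmax l)"

definition expected_kl ::
  "'w measure \<Rightarrow> ('w \<Rightarrow> 'v::finite \<Rightarrow> real) \<Rightarrow> ('w \<Rightarrow> 'v set) \<Rightarrow> real \<Rightarrow> real" where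
  "expected_kl M L G \<delta> = (\<integral>\<omega>. token_kl (L \<omega>) (G \<omega>) \<delta> \<partial>M)"

definition green_mass :: "('v::finite \<Rightarrow> real) \<Rightarrow> 'v set \<Rightarrow> real" where
  "green_mass l G = measure_pmf.prob (softmax l) G"

definition watermarked_green_mass :: "('v::finite \<Rightarrow> real) \<Rightarrow> 'v set \<Rightarrow> real \<Rightarrow> real" where
  "watermarked_green_mass l G \<delta> = measure_pmf.prob (watermarked l G \<delta>) G"

lemma pmf_softmax: "pmf (softmax l) v = exp (l v) / (\<Sum>u\<in>UNIV. exp (l u))"
proof -
  have pos: "(\<Sum>u\<in>UNIV. exp (l u)) > 0" by (intro sum_pos) auto
  have "(\<integral>\<^sup>+v. ennreal (exp (l v) / (\<Sum>u\<in>UNIV. exp (l u))) \<partial>count_space UNIV) = 1"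
    using pos by (simp add: nn_integral_count_space_finite sum_divide_distrib[symmetric] divide_nonneg_pos)
  then show ?thesis
    unfolding softmax_def using pos by (subst pmf_embed_pmf) (auto intro!: divide_nonneg_pos)
qed

lemma pmf_watermarked:
  "pmf (watermarked l G \<delta>) v =
     exp (\<delta> * indicator G v) * pmf (softmax l) v /
     (\<Sum>u\<in>UNIV. exp (\<delta> * indicator G u) * pmf (softmax l) u)"
proof -
  have pos: "(\<Sum>u\<in>UNIV. exp (l u)) > 0" by (intro sum_pos) auto
  have "(\<Sum>u\<in>UNIV. exp (\<delta> * indicator G u) * pmf (softmax l) u) =
      (\<Sum>u\<in>UNIV. exp (l u + \<delta> * indicator G u)) / (\<Sum>u\<in>UNIV. exp (l u))"
    by (simp add: pmf_softmax exp_add sum_divide_distrib mult.commute)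
  then show ?thesis
    using pos unfolding watermarked_def pmf_softmax by (simp add: exp_add mult.commute)
qed

lemma kl_eq_sum:
  fixes P Q :: "'a::finite pmf"
  assumes "\<And>v. pmf P v = 0 \<Longrightarrow> pmf Q v = 0"
  shows "kl Q P = (\<Sum>v\<in>UNIV. pmf Q v * ln (pmf Q v / pmf P v))"
proof -
  interpret sigma_finite_measure "count_space (UNIV :: 'a set)"
    by (rule sigma_finite_measure_count_space_finite) simp
  have "kl Q P = (\<integral>v. pmf Q v * log (exp 1) (pmf Q v / pmf P v) \<partial>count_space UNIV)"
    unfolding kl_def measure_pmf_eq_density
    using assms by (intro KL_density_density) (auto simp: AE_count_space)
  then show ?thesis
    by (simp add: lebesgue_integral_count_space_finite log_def)
qed

end

theory Submission
  imports Defs "HOL-Real_Asymp.Real_Asymp"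
begin

text \<open>
  The watermark rescales every token probability by a factor that depends only on whether the token
  is green, so the divergence of one step depends on the logits only through the green mass \<open>m\<close>: it
  equals the divergence between the Bernoulli laws of the green indicator. For the resulting function
  of \<open>\<gamma>\<close> and \<open>\<delta>\<close>, the derivative in \<open>\<delta>\<close> is \<open>\<delta>\<close> times that of \<open>\<gamma>'\<close>; the difference to \<open>- ln \<gamma>\<close> is
  \<open>\<delta> * (\<gamma>' - 1) + ln \<gamma>'\<close>, which is negative and vanishes as \<open>\<delta>\<close> tends to infinity; and with
  \<open>Z = 1 + \<gamma> (exp \<delta> - 1)\<close> and \<open>c = \<delta> exp \<delta> / (exp \<delta> - 1)\<close> it reads \<open>c - c / Z - ln Z\<close>, which
  \<open>ln x \<le> x - 1\<close> shows to be maximal at \<open>Z = c\<close>.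
\<close>

section \<open>Closed form of the plug-in divergence\<close>

lemma partition_pos:
  fixes g \<delta> :: real
  assumes "0 \<le> g" "g \<le> 1"
  shows "1 + g * (exp \<delta> - 1) > 0"
proof (cases "g = 1")
  case False
  have "1 + g * (exp \<delta> - 1) = (1 - g) + g * exp \<delta>" by (simp add: algebra_simps)
  also have "\<dots> > 0" using assms False by (intro add_pos_nonneg) auto
  finally show ?thesis .
qed simp

lemma eff_green_bounds:
  assumes "0 \<le> g" "g \<le> 1"
  shows "0 \<le> eff_green g \<delta>" "eff_green g \<delta> \<le> 1"
proof -
  note Z = partition_pos[OF assms, of \<delta>]
  show "0 \<le> eff_green g \<delta>" using assms Z by (simp add: eff_green_def)
  show "eff_green g \<delta> \<le> 1"
    using assms Z by (simp add: eff_green_def divide_le_eq algebra_simps)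
qed

text \<open>With \<open>Z = 1 + g * (exp \<delta> - 1)\<close>, the likelihood ratio is
  \<open>exp \<delta> / Z\<close> on the green outcome and \<open>1 / Z\<close> on the other. The
  endpoints of \<open>g\<close> are covered because the formula is later applied to a green
  mass.\<close>

lemma plugin_kl_eq:
  assumes g: "0 \<le> g" "g \<le> 1"
  shows "plugin_kl g \<delta> = \<delta> * eff_green g \<delta> - ln (1 + g * (exp \<delta> - 1))"
proof -
  define Z where "Z = 1 + g * (exp \<delta> - 1)"
  have Z: "Z > 0" using partition_pos[OF g] by (simp add: Z_def)
  let ?q = "eff_green g \<delta>"
  note q = eff_green_bounds[OF g, of \<delta>]
  have q_eq: "?q = exp \<delta> * g / Z" "1 - ?q = (1 - g) / Z"
    using Z by (auto simp: eff_green_def Z_def field_simps)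
  have "plugin_kl g \<delta> = ?q * ln (?q / g) + (1 - ?q) * ln ((1 - ?q) / (1 - g))"
    unfolding plugin_kl_def
  proof (subst kl_eq_sum)
    fix b show "pmf (bernoulli_pmf g) b = 0 \<Longrightarrow> pmf (bernoulli_pmf ?q) b = 0"
      using g q q_eq by (cases b) auto
  qed (use g q in \<open>simp add: UNIV_bool\<close>)
  \<comment> \<open>At \<open>g = 0\<close> the quotient is a division by zero, but its weight
    \<open>?q\<close> vanishes; likewise \<open>1 - ?q\<close> at \<open>g = 1\<close>
    below.\<close>
  also have "?q * ln (?q / g) = ?q * (\<delta> - ln Z)"
    using Z g by (cases "g = 0") (simp add: eff_green_def, simp add: q_eq(1) ln_div)
  also have "(1 - ?q) * ln ((1 - ?q) / (1 - g)) = (1 - ?q) * (- ln Z)"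
    using Z g by (cases "g = 1") (simp add: eff_green_def, simp add: q_eq(2) ln_div)
  finally show ?thesis by (simp add: algebra_simps Z_def)
qed

section \<open>Reduction of one generation step to the green mass\<close>

lemma green_mass_eq_sum: "green_mass l G = (\<Sum>v\<in>UNIV. indicator G v * pmf (softmax l) v)"
  unfolding green_mass_def
  by (simp add: measure_measure_pmf_finite indicator_def if_distrib sum.If_cases cong: if_cong)

lemma green_mass_bounds: "0 \<le> green_mass l G" "green_mass l G \<le> 1"
  by (simp_all add: green_mass_def)

text \<open>The factor \<open>exp (\<delta> * indicator G u)\<close> equals
  \<open>1 + (exp \<delta> - 1) * indicator G u\<close>, so summing it against a probability vector
  leaves only the green mass.\<close>

lemma partition_eq:
  "(\<Sum>u\<in>UNIV. exp (\<delta> * indicator G u) * pmf (softmax l) u) = 1 + green_mass l G * (exp \<delta> - 1)"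
proof -
  have "(\<Sum>u\<in>UNIV. exp (\<delta> * indicator G u) * pmf (softmax l) u) =
      (\<Sum>u\<in>UNIV. pmf (softmax l) u + (exp \<delta> - 1) * (indicator G u * pmf (softmax l) u))"
    by (intro sum.cong) (auto simp: indicator_def algebra_simps)
  then show ?thesis
    by (simp add: sum.distrib sum_distrib_left[symmetric] green_mass_eq_sum sum_pmf_eq_1 mult.commute)
qed

lemma watermarked_green_mass_eq:
  "watermarked_green_mass l G \<delta> = eff_green (green_mass l G) \<delta>"
proof -
  have "watermarked_green_mass l G \<delta> = (\<Sum>v\<in>UNIV. indicator G v * pmf (watermarked l G \<delta>) v)"
    unfolding watermarked_green_mass_def watermarked_def green_mass_def[symmetric]
    \<comment> \<open>The watermarked law is itself a softmax, of the shifted logits.\<close>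
    by (rule green_mass_eq_sum)
  also have "\<dots> = (\<Sum>v\<in>UNIV. exp \<delta> * (indicator G v * pmf (softmax l) v)) /
      (1 + green_mass l G * (exp \<delta> - 1))"
    unfolding pmf_watermarked partition_eq sum_divide_distrib
    by (intro sum.cong) (auto simp: indicator_def)
  finally show ?thesis
    by (simp add: eff_green_def sum_distrib_left[symmetric] green_mass_eq_sum)
qed

text \<open>The log-likelihood ratio \<open>\<delta> * indicator G v - ln Z\<close> is affine in the
  green indicator, so its mean under the watermarked law needs only the watermarked green
  mass.\<close>

lemma token_kl_eq_plugin_kl: "token_kl l G \<delta> = plugin_kl (green_mass l G) \<delta>"
proof -
  define Z where "Z = 1 + green_mass l G * (exp \<delta> - 1)"
  have Z: "Z > 0" using partition_pos[OF green_mass_bounds] by (simp add: Z_def)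
  let ?Q = "watermarked l G \<delta>"
  have pos: "pmf (softmax l) v > 0" for v
    unfolding pmf_softmax by (intro divide_pos_pos sum_pos) auto
  have ratio: "pmf ?Q v / pmf (softmax l) v = exp (\<delta> * indicator G v) / Z" for v
    using pos[of v] by (simp add: pmf_watermarked partition_eq Z_def)
  have "token_kl l G \<delta> = (\<Sum>v\<in>UNIV. pmf ?Q v * ln (pmf ?Q v / pmf (softmax l) v))"
    unfolding token_kl_def by (rule kl_eq_sum) (use pos in \<open>metis less_irrefl\<close>)
  also have "\<dots> = (\<Sum>v\<in>UNIV. \<delta> * (indicator G v * pmf ?Q v) - ln Z * pmf ?Q v)"
    unfolding ratio using Z by (intro sum.cong) (auto simp: ln_div algebra_simps)
  also have "\<dots> = \<delta> * green_mass (\<lambda>v. l v + \<delta> * indicator G v) G - ln Z"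
    by (simp add: sum_subtractf sum_distrib_left[symmetric] green_mass_eq_sum sum_pmf_eq_1
      watermarked_def[symmetric])
  also have "green_mass (\<lambda>v. l v + \<delta> * indicator G v) G = eff_green (green_mass l G) \<delta>"
    using watermarked_green_mass_eq[of l G \<delta>]
    by (simp add: watermarked_green_mass_def watermarked_def green_mass_def)
  finally show ?thesis
    by (simp add: plugin_kl_eq[OF green_mass_bounds] Z_def)
qed

section \<open>Measurability and integrability over the random context\<close>

lemma (in watermark_step) green_mass_measurable [measurable]:
  "(\<lambda>\<omega>. green_mass (L \<omega>) (G \<omega>)) \<in> borel_measurable M"
proof -
  note logits_measurable [measurable]
  have [measurable]: "(\<lambda>\<omega>. indicator (G \<omega>) v :: real) \<in> borel_measurable M" for v
    by (rule measurable_compose[OF green_measurable]) simp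
  show ?thesis
    unfolding green_mass_eq_sum pmf_softmax by measurable
qed

text \<open>Each of the two terms of the closed form is at most \<open>\<bar>\<delta>\<bar>\<close>
  in absolute value: \<open>eff_green\<close> lies between 0 and 1, and the normalizer lies between
  1 and \<open>exp \<delta>\<close>.\<close>

lemma (in watermark_step) token_kl_integrable:
  "integrable M (\<lambda>\<omega>. token_kl (L \<omega>) (G \<omega>) \<delta>)"
proof (rule integrable_const_bound)
  have eq: "token_kl (L \<omega>) (G \<omega>) \<delta> = \<delta> * eff_green (green_mass (L \<omega>) (G \<omega>)) \<delta> -
      ln (1 + green_mass (L \<omega>) (G \<omega>) * (exp \<delta> - 1))" for \<omega>
    by (simp add: token_kl_eq_plugin_kl plugin_kl_eq[OF green_mass_bounds])
  show "(\<lambda>\<omega>. token_kl (L \<omega>) (G \<omega>) \<delta>) \<in> borel_measurable M"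
    unfolding eq eff_green_def by measurable
  have "\<bar>\<delta> * eff_green g \<delta> - ln (1 + g * (exp \<delta> - 1))\<bar> \<le> 2 * \<bar>\<delta>\<bar>" if g: "0 \<le> g" "g \<le> 1" for g
  proof -
    have "\<bar>\<delta> * eff_green g \<delta>\<bar> \<le> \<bar>\<delta>\<bar> * 1"
      unfolding abs_mult using eff_green_bounds[OF g, of \<delta>] by (intro mult_left_mono) auto
    moreover have "\<bar>ln (1 + g * (exp \<delta> - 1))\<bar> \<le> \<bar>\<delta>\<bar>"
    proof (cases "\<delta> \<ge> 0")
      case True
      then have "1 \<le> 1 + g * (exp \<delta> - 1)" "1 + g * (exp \<delta> - 1) \<le> exp \<delta>"
        using g mult_right_mono[of g 1 "exp \<delta> - 1"] by auto
      then have "0 \<le> ln (1 + g * (exp \<delta> - 1))" "ln (1 + g * (exp \<delta> - 1)) \<le> ln (exp \<delta>)"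
        by (simp, intro ln_mono) auto
      then show ?thesis using True by simp
    next
      case False
      then have "exp \<delta> - 1 \<le> 0" by simp
      then have "1 + g * (exp \<delta> - 1) \<le> 1" "exp \<delta> \<le> 1 + g * (exp \<delta> - 1)"
        using mult_right_mono_neg[OF g(2)] mult_nonneg_nonpos[OF g(1)] by fastforce+
      then have "ln (1 + g * (exp \<delta> - 1)) \<le> ln 1" "ln (exp \<delta>) \<le> ln (1 + g * (exp \<delta> - 1))"
        using partition_pos[OF g, of \<delta>] by (intro ln_mono; simp)+
      then show ?thesis using False by simp
    qed
    ultimately show ?thesis by linarith
  qed
  then show "AE \<omega> in M. norm (token_kl (L \<omega>) (G \<omega>) \<delta>) \<le> 2 * \<bar>\<delta>\<bar>"
    by (simp add: eq green_mass_bounds)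
qed

section \<open>Monotonicity and supremum in the logit bias\<close>

text \<open>The derivative of \<open>ln Z\<close> is \<open>eff_green g \<delta>\<close>, which
  cancels the first term of the product rule for
  \<open>\<delta> * eff_green g \<delta>\<close>.\<close>

lemma plugin_kl_has_derivative:
  assumes g: "0 \<le> g" "g \<le> 1"
  shows "(plugin_kl g has_real_derivative
      \<delta> * (exp \<delta> * g * (1 - g) / (1 + g * (exp \<delta> - 1))\<^sup>2)) (at \<delta>)"
proof -
  define Z where "Z = 1 + g * (exp \<delta> - 1)"
  have Z: "Z > 0" using partition_pos[OF g] by (simp add: Z_def)
  have eq: "plugin_kl g = (\<lambda>\<delta>. \<delta> * (exp \<delta> * g / (1 + g * (exp \<delta> - 1))) - ln (1 + g * (exp \<delta> - 1)))"
    using plugin_kl_eq[OF g] by (auto simp: eff_green_def)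
  have dZ: "((\<lambda>\<delta>. 1 + g * (exp \<delta> - 1)) has_real_derivative g * exp \<delta>) (at \<delta>)"
    by (auto intro!: derivative_eq_intros)
  have "((\<lambda>\<delta>. exp \<delta> * g / (1 + g * (exp \<delta> - 1))) has_real_derivative
      (exp \<delta> * g * Z - exp \<delta> * g * (g * exp \<delta>)) / (Z * Z)) (at \<delta>)"
    unfolding Z_def using Z
    by (intro DERIV_divide dZ) (auto simp: Z_def intro!: derivative_eq_intros)
  also have "exp \<delta> * g * Z - exp \<delta> * g * (g * exp \<delta>) = exp \<delta> * g * (1 - g)"
    by (simp add: Z_def algebra_simps)
  finally have "((\<lambda>\<delta>. \<delta> * (exp \<delta> * g / (1 + g * (exp \<delta> - 1)))) has_real_derivative
      1 * (exp \<delta> * g / Z) + exp \<delta> * g * (1 - g) / (Z * Z) * \<delta>) (at \<delta>)"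
    unfolding Z_def by (intro DERIV_mult DERIV_ident)
  moreover have "((\<lambda>\<delta>. ln (1 + g * (exp \<delta> - 1))) has_real_derivative 1 / Z * (g * exp \<delta>)) (at \<delta>)"
    using Z unfolding Z_def by (intro DERIV_chain2[OF DERIV_ln_divide dZ])
  ultimately show ?thesis
    unfolding eq Z_def[symmetric] power2_eq_square
    by (rule DERIV_cong[OF DERIV_diff]) (simp add: mult.commute)
qed

lemma plugin_kl_derivative_pos:
  assumes "0 < g" "g < 1" "0 < \<delta>"
  shows "\<exists>D>0. (plugin_kl g has_real_derivative D) (at \<delta>)"
  using plugin_kl_has_derivative[of g \<delta>] partition_pos[of g \<delta>] assms
  by (intro exI conjI) (auto intro!: mult_pos_pos divide_pos_pos)

lemma plugin_kl_strict_mono: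
  assumes "0 < g" "g < 1"
  shows "strict_mono_on {0<..} (plugin_kl g)"
proof (rule strict_mono_onI)
  fix a b :: real assume "a \<in> {0<..}" "b \<in> {0<..}" "a < b"
  show "plugin_kl g a < plugin_kl g b"
  proof (rule DERIV_pos_imp_increasing[OF \<open>a < b\<close>])
    fix x assume "a \<le> x"
    then have "0 < x" using \<open>a \<in> {0<..}\<close> by simp
    then show "\<exists>D. (plugin_kl g has_real_derivative D) (at x) \<and> D > 0"
      using plugin_kl_derivative_pos[OF assms] by blast
  qed
qed

lemma plugin_kl_le:
  assumes "0 < g" "g \<le> 1" "0 \<le> \<delta>"
  shows "plugin_kl g \<delta> \<le> - ln g"
proof -
  have Z: "1 + g * (exp \<delta> - 1) > 0" using partition_pos assms by simp
  have q: "eff_green g \<delta> \<le> 1" using eff_green_bounds assms by simp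
  have "eff_green g \<delta> > 0" using Z assms by (simp add: eff_green_def)
  then have "ln (eff_green g \<delta>) \<le> 0" using q by simp
  moreover have "ln (eff_green g \<delta>) = \<delta> + ln g - ln (1 + g * (exp \<delta> - 1))"
    using Z assms by (simp add: eff_green_def ln_div ln_mult)
  moreover have "\<delta> * eff_green g \<delta> \<le> \<delta>" using q assms(3) by (simp add: mult_left_le)
  moreover have "plugin_kl g \<delta> = \<delta> * eff_green g \<delta> - ln (1 + g * (exp \<delta> - 1))"
    using plugin_kl_eq assms by simp
  ultimately show ?thesis by linarith
qed

text \<open>Since \<open>1 - eff_green g \<delta>\<close> decays like
  \<open>exp (- \<delta>)\<close>, its product with \<open>\<delta>\<close> still vanishes in the
  limit.\<close>

lemma plugin_kl_tendsto:
  assumes "0 < g" "g < 1"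
  shows "(plugin_kl g \<longlongrightarrow> - ln g) at_top"
proof -
  have "plugin_kl g = (\<lambda>\<delta>. \<delta> * (exp \<delta> * g / (1 + g * (exp \<delta> - 1))) - ln (1 + g * (exp \<delta> - 1)))"
    using plugin_kl_eq[of g] assms by (auto simp: eff_green_def)
  then show ?thesis using assms by simp real_asymp
qed

text \<open>Boundedness is recorded because a real \<open>SUP\<close> is meaningful only for sets
  bounded above.\<close>

lemma plugin_kl_SUP:
  assumes "0 < g" "g < 1"
  shows "bdd_above (plugin_kl g ` {0<..})" "(SUP d\<in>{0<..}. plugin_kl g d) = - ln g"
proof -
  have le: "plugin_kl g d \<le> - ln g" if "d \<in> {0<..}" for d
    using plugin_kl_le that assms by simp
  then show bdd: "bdd_above (plugin_kl g ` {0<..})" by (intro bdd_aboveI2)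
  show "(SUP d\<in>{0<..}. plugin_kl g d) = - ln g"
  proof (rule antisym)
    show "(SUP d\<in>{0<..}. plugin_kl g d) \<le> - ln g"
      using le by (intro cSUP_least) auto
    have "\<forall>\<^sub>F d in at_top. plugin_kl g d \<le> (SUP d\<in>{0<..}. plugin_kl g d)"
      using eventually_gt_at_top[of 0] by eventually_elim (auto intro: cSUP_upper bdd)
    then show "- ln g \<le> (SUP d\<in>{0<..}. plugin_kl g d)"
      using plugin_kl_tendsto[OF assms] by (intro tendsto_upperbound) auto
  qed
qed

section \<open>Maximum over the green fraction\<close>

text \<open>These inequalities place \<open>peak_fraction \<delta>\<close> strictly between 0 and 1.
  Both come from the strict bound \<open>1 + x < exp x\<close>, at \<open>\<delta>\<close> and at
  \<open>- \<delta>\<close>.\<close>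

lemma exp_minus_one_bounds:
  fixes \<delta> :: real
  assumes "0 < \<delta>"
  shows "\<delta> < exp \<delta> - 1" "exp \<delta> - 1 < \<delta> * exp \<delta>"
proof -
  have gt: "1 + x < exp x" if "x \<noteq> 0" for x :: real
  proof -
    \<comment> \<open>Strictness comes from the equality case of \<open>ln y \<le> y - 1\<close>,
      which is only \<open>y = 1\<close>.\<close>
    have "1 + x \<noteq> exp x" using ln_eq_minus_one[of "exp x"] that by auto
    then show ?thesis using exp_ge_add_one_self[of x] by linarith
  qed
  show "\<delta> < exp \<delta> - 1" using gt[of \<delta>] assms by simp
  have "(1 - \<delta>) * exp \<delta> < exp (- \<delta>) * exp \<delta>"
    using gt[of "- \<delta>"] assms by (intro mult_strict_right_mono) auto
  then show "exp \<delta> - 1 < \<delta> * exp \<delta>"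
    by (simp add: exp_minus algebra_simps)
qed

lemma peak_fraction_is_arg_max:
  assumes "0 < \<delta>"
  shows "is_arg_max (\<lambda>g. plugin_kl g \<delta>) (\<lambda>g. 0 < g \<and> g < 1) (peak_fraction \<delta>)"
proof -
  define a where "a = exp \<delta> - 1"
  define c where "c = \<delta> * exp \<delta> / a"
  have a: "a > 0" "\<delta> < a" "a < \<delta> * exp \<delta>"
    using assms exp_minus_one_bounds[OF assms] by (auto simp: a_def)
  have c: "1 < c" "c < 1 + a"
    using a by (auto simp: c_def a_def divide_less_eq mult.commute)
  \<comment> \<open>This is the solution \<open>g\<close> of \<open>1 + g * a = c\<close>.\<close>
  have peak: "peak_fraction \<delta> = (c - 1) / a"
    using a by (simp add: peak_fraction_def a_def[symmetric] c_def power2_eq_square field_simps)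
  have kl: "plugin_kl g \<delta> = c - (c / (1 + g * a) + ln (1 + g * a))" if "0 < g" "g < 1" for g
  proof -
    have "1 + g * a > 0" using partition_pos[of g \<delta>] that by (simp add: a_def)
    then have "c - c / (1 + g * a) = c * a * g / (1 + g * a)"
      by (simp add: field_simps)
    also have "\<dots> = \<delta> * eff_green g \<delta>"
      using a unfolding eff_green_def a_def[symmetric] by (simp add: c_def)
    finally have "\<delta> * eff_green g \<delta> = c - c / (1 + g * a)" ..
    then show ?thesis using plugin_kl_eq[of g \<delta>] that by (simp add: a_def)
  qed
  have peak_in: "0 < peak_fraction \<delta>" "peak_fraction \<delta> < 1"
    using a c by (auto simp: peak)
  have "plugin_kl g \<delta> \<le> plugin_kl (peak_fraction \<delta>) \<delta>" if g: "0 < g" "g < 1" for g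
  proof -
    have Z: "1 + g * a > 0" using a g by (simp add: add_pos_pos)
    \<comment> \<open>This tangent bound is an equality exactly when
      \<open>1 + g * a = c\<close>.\<close>
    have "ln (c / (1 + g * a)) \<le> c / (1 + g * a) - 1"
      using c Z by (intro ln_le_minus_one) simp
    then have "ln c + 1 \<le> c / (1 + g * a) + ln (1 + g * a)"
      using c Z by (simp add: ln_div)
    moreover have "1 + peak_fraction \<delta> * a = c" using a by (simp add: peak)
    ultimately show ?thesis
      using kl[OF g] kl[OF peak_in] c by simp
  qed
  then show ?thesis
    using peak_in unfolding is_arg_max_def not_less[symmetric] by blast
qed

text \<open>The plug-in approximation enters as the hypothesis that the green mass is almost surely
  \<open>\<gamma>\<close>; the step identities before it are exact.\<close>

theorem lemma3p9:
  fixes \<gamma> \<delta> :: real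
  assumes "0 < \<gamma>" and "\<gamma> < 1" and "0 < \<delta>"
  shows
    "(\<forall>(M :: 'w measure) (L :: 'w \<Rightarrow> 'v::finite \<Rightarrow> real) G. watermark_step M L G \<gamma> \<longrightarrow>
        (\<forall>\<omega>\<in>space M. watermarked_green_mass (L \<omega>) (G \<omega>) \<delta> = eff_green (green_mass (L \<omega>) (G \<omega>)) \<delta>) \<and>
        integrable M (\<lambda>\<omega>. token_kl (L \<omega>) (G \<omega>) \<delta>) \<and>
        expected_kl M L G \<delta> = (\<integral>\<omega>. plugin_kl (green_mass (L \<omega>) (G \<omega>)) \<delta> \<partial>M) \<and>
        ((AE \<omega> in M. green_mass (L \<omega>) (G \<omega>) = \<gamma>) \<longrightarrow>
           (\<integral>\<omega>. watermarked_green_mass (L \<omega>) (G \<omega>) \<delta> \<partial>M) = eff_green \<gamma> \<delta> \<and>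
           expected_kl M L G \<delta> = plugin_kl \<gamma> \<delta>)) \<and>
     plugin_kl \<gamma> \<delta> = \<delta> * eff_green \<gamma> \<delta> - ln (1 + \<gamma> * (exp \<delta> - 1)) \<and>
     (\<exists>D>0. (plugin_kl \<gamma> has_real_derivative D) (at \<delta>)) \<and>
     strict_mono_on {0<..} (plugin_kl \<gamma>) \<and>
     bdd_above (plugin_kl \<gamma> ` {0<..}) \<and>
     (SUP d\<in>{0<..}. plugin_kl \<gamma> d) = - ln \<gamma> \<and>
     is_arg_max (\<lambda>g. plugin_kl g \<delta>) (\<lambda>g. 0 < g \<and> g < 1) (peak_fraction \<delta>)"
proof (intro conjI allI impI ballI)
  fix M :: "'w measure" and L :: "'w \<Rightarrow> 'v \<Rightarrow> real" and G
  assume step: "watermark_step M L G \<gamma>"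
  then interpret watermark_step M L G \<gamma> .
  show "integrable M (\<lambda>\<omega>. token_kl (L \<omega>) (G \<omega>) \<delta>)"
    by (rule token_kl_integrable)
  show kl: "expected_kl M L G \<delta> = (\<integral>\<omega>. plugin_kl (green_mass (L \<omega>) (G \<omega>)) \<delta> \<partial>M)"
    by (simp add: expected_kl_def token_kl_eq_plugin_kl)
  assume ae: "AE \<omega> in M. green_mass (L \<omega>) (G \<omega>) = \<gamma>"
  have "(\<integral>\<omega>. watermarked_green_mass (L \<omega>) (G \<omega>) \<delta> \<partial>M) = (\<integral>\<omega>. eff_green \<gamma> \<delta> \<partial>M)"
    unfolding watermarked_green_mass_eq
    by (rule integral_cong_AE) (use ae in \<open>auto simp: eff_green_def\<close>)
  then show "(\<integral>\<omega>. watermarked_green_mass (L \<omega>) (G \<omega>) \<delta> \<partial>M) = eff_green \<gamma> \<delta>"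
    by (simp add: prob_space)
  \<comment> \<open>Integrability supplies the measurability that \<open>integral_cong_AE\<close>
    requires.\<close>
  have "expected_kl M L G \<delta> = (\<integral>\<omega>. plugin_kl \<gamma> \<delta> \<partial>M)"
    unfolding kl
    by (rule integral_cong_AE)
      (use ae token_kl_integrable[of \<delta>] in \<open>auto simp: token_kl_eq_plugin_kl\<close>)
  then show "expected_kl M L G \<delta> = plugin_kl \<gamma> \<delta>"
    by (simp add: prob_space)
qed (use assms in \<open>simp_all add: watermarked_green_mass_eq plugin_kl_eq[of \<gamma> \<delta>]
  plugin_kl_derivative_pos plugin_kl_strict_mono plugin_kl_SUP peak_fraction_is_arg_max\<close>)

end
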